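(* Let $T$ be the torsion of the canonical connection $\nabla'$ on a Riemannian almost product $\mathcal{W}_3$-manifold $(M,P,g)$. Then for all $x,y,z,w$ the following hold: \[ T(Px,y)=-P\,T(x,y), \] \[ T(Px,y,z)=T(x,Py,z)=-T(x,y,Pz), \] \[ T\bigl(T(Px,Py),z,w\bigr)=T\bigl(T(Px,y),z,Pw\bigr)=T\bigl(T(x,Py),z,Pw\bigr)=T\bigl(T(x,y),z,w\bigr), \] \[ T=p_3,\quad\text{where } p_3(x,y,z)=\tfrac14\bigl\{T(x,y,z)+T(Px,Py,z)-T(Px,y,Pz)-T(x,Py,Pz)\bigr\}, \] and $\nabla'$ is determined by \[ \nabla'_xy=\nabla_xy+\tfrac14\bigl\{-(\nabla_yP)Px+(\nabla_{Py}P)x-2(\nabla_xP)Py\bigr\}. \]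
   Context: A Riemannian almost product manifold $(M,P,g)$ is a differentiable manifold $M$ with a $(1,1)$-tensor field $P$ and a Riemannian metric $g$ such that $P^2x=x$ and $g(Px,Py)=g(x,y)$ for all vector fields $x,y$; throughout it is assumed that $\mathrm{tr}\,P=0$. Let $\nabla$ be the Levi-Civita connection of $g$ and $F(x,y,z)=g((\nabla_xP)y,z)$. $(M,P,g)$ is a Riemannian almost product $\mathcal{W}_3$-manifold if $F(x,y,z)+F(y,z,x)+F(z,x,y)=0$ for all $x,y,z$. A natural connection is a linear connection $\nabla'$ with $\nabla'P=0$ and $\nabla'g=0$; its torsion is $T(x,y)=\nabla'_xy-\nabla'_yx-[x,y]$, with corresponding $(0,3)$-tensor $T(x,y,z)=g(T(x,y),z)$. The canonical connection is the natural connection whose torsion satisfies \[T(x,y,z)+T(y,z,x)+T(Px,y,Pz)+T(y,Pz,Px)=0\] for all $x,y,z$; it is known that it exists and is unique on every Riemannian almost product manifold. *)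

theory Defs
  imports "HOL-Analysis.Analysis" "HOL-Library.Function_Algebras"
begin

text \<open>
  The underlying set of the manifold is a whole type of class Hausdorff and second countable;
  the model space is \<open>real ^ 'n\<close>, so the (arbitrary, positive) dimension is \<open>CARD('n)\<close>.
  Sums, differences and negatives of functions are the pointwise ones.
\<close>

text \<open>
  \<open>Ck_on k f S\<close> is only meant for open \<open>S\<close>: \<open>f\<close> is \<open>k\<close> times continuously differentiable on \<open>S\<close>.
  In finite dimension it suffices that every directional derivative is \<open>k - 1\<close> times so.
\<close>

fun Ck_on ::
  "nat \<Rightarrow> ('a::real_normed_vector \<Rightarrow> 'b::real_normed_vector) \<Rightarrow> 'a set \<Rightarrow> bool" where
  "Ck_on 0 f S \<longleftrightarrow> continuous_on S f"
| "Ck_on (Suc k) f S \<longleftrightarrow>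
     (\<forall>x\<in>S. f differentiable (at x)) \<and>
     (\<forall>v. Ck_on k (\<lambda>x. frechet_derivative f (at x) v) S)"

definition smooth_on ::
  "('a::real_normed_vector \<Rightarrow> 'b::real_normed_vector) \<Rightarrow> 'a set \<Rightarrow> bool" where
  "smooth_on f S \<longleftrightarrow> (\<forall>k. Ck_on k f S)"

type_synonym ('m, 'n) chart = "'m set \<times> ('m \<Rightarrow> real ^ 'n)"
type_synonym ('m, 'n) atlas = "('m, 'n) chart set"

definition smooth_atlas ::
  "('m::{t2_space, second_countable_topology}, 'n::finite) atlas \<Rightarrow> bool" where
  "smooth_atlas A \<longleftrightarrow>
     (\<Union>(U, \<phi>)\<in>A. U) = UNIV \<and>
     (\<forall>(U, \<phi>)\<in>A. open U \<and> open (\<phi> ` U) \<and>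
        homeomorphism U (\<phi> ` U) \<phi> (inv_into U \<phi>)) \<and>
     (\<forall>(U, \<phi>)\<in>A. \<forall>(V, \<psi>)\<in>A. smooth_on (\<psi> \<circ> inv_into U \<phi>) (\<phi> ` (U \<inter> V)))"

definition smooth_fun :: "('m, 'n::finite) atlas \<Rightarrow> ('m \<Rightarrow> real) \<Rightarrow> bool" where
  "smooth_fun A f \<longleftrightarrow> (\<forall>(U, \<phi>)\<in>A. smooth_on (f \<circ> inv_into U \<phi>) (\<phi> ` U))"

text \<open>
  A tangent vector at \<open>p\<close> is a derivation at \<open>p\<close> of the algebra of smooth functions on the manifold;
  its value on functions that are not smooth is fixed to be \<open>0\<close>, so that equality of tangent
  vectors is equality of HOL functions.
\<close>

type_synonym 'm tvec = "('m \<Rightarrow> real) \<Rightarrow> real"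
type_synonym 'm vfield = "'m \<Rightarrow> 'm tvec"

definition tangent_space :: "('m, 'n::finite) atlas \<Rightarrow> 'm \<Rightarrow> 'm tvec set" where
  "tangent_space A p = {v.
     (\<forall>f h. smooth_fun A f \<longrightarrow> smooth_fun A h \<longrightarrow>
        v (\<lambda>q. f q + h q) = v f + v h \<and>
        v (\<lambda>q. f q * h q) = f p * v h + h p * v f) \<and>
     (\<forall>c f. smooth_fun A f \<longrightarrow> v (\<lambda>q. c * f q) = c * v f) \<and>
     (\<forall>f. \<not> smooth_fun A f \<longrightarrow> v f = 0)}"

definition tscale :: "real \<Rightarrow> 'm tvec \<Rightarrow> 'm tvec" where
  "tscale c v = (\<lambda>f. c * v f)"

definition deriv_along :: "'m vfield \<Rightarrow> ('m \<Rightarrow> real) \<Rightarrow> 'm \<Rightarrow> real" where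
  "deriv_along x f = (\<lambda>p. x p f)"

definition vector_field :: "('m, 'n::finite) atlas \<Rightarrow> 'm vfield \<Rightarrow> bool" where
  "vector_field A x \<longleftrightarrow>
     (\<forall>p. x p \<in> tangent_space A p) \<and>
     (\<forall>f. smooth_fun A f \<longrightarrow> smooth_fun A (deriv_along x f))"

definition fscale :: "('m \<Rightarrow> real) \<Rightarrow> 'm vfield \<Rightarrow> 'm vfield" where
  "fscale f x = (\<lambda>p. tscale (f p) (x p))"

abbreviation cscale :: "real \<Rightarrow> 'm vfield \<Rightarrow> 'm vfield" where
  "cscale c \<equiv> fscale (\<lambda>_. c)"

definition lie_bracket :: "'m vfield \<Rightarrow> 'm vfield \<Rightarrow> 'm vfield" where
  "lie_bracket x y = (\<lambda>p f. x p (deriv_along y f) - y p (deriv_along x f))"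

text \<open>
  A \<open>(1,1)\<close>-tensor field is a family of endomorphisms of the tangent spaces, and a metric a family
  of inner products on them; smoothness is tested on vector fields. Their values outside the
  tangent spaces are irrelevant.
\<close>

type_synonym 'm endo = "'m \<Rightarrow> 'm tvec \<Rightarrow> 'm tvec"
type_synonym 'm bilin = "'m \<Rightarrow> 'm tvec \<Rightarrow> 'm tvec \<Rightarrow> real"

definition endo_apply :: "'m endo \<Rightarrow> 'm vfield \<Rightarrow> 'm vfield" where
  "endo_apply P x = (\<lambda>p. P p (x p))"

definition bilin_apply :: "'m bilin \<Rightarrow> 'm vfield \<Rightarrow> 'm vfield \<Rightarrow> 'm \<Rightarrow> real" where
  "bilin_apply g x y = (\<lambda>p. g p (x p) (y p))"

definition tensor_field_11 :: "('m, 'n::finite) atlas \<Rightarrow> 'm endo \<Rightarrow> bool" where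
  "tensor_field_11 A P \<longleftrightarrow>
     (\<forall>p. \<forall>v\<in>tangent_space A p. P p v \<in> tangent_space A p \<and>
        (\<forall>w\<in>tangent_space A p. P p (v + w) = P p v + P p w) \<and>
        (\<forall>c. P p (tscale c v) = tscale c (P p v))) \<and>
     (\<forall>x. vector_field A x \<longrightarrow> vector_field A (endo_apply P x))"

definition riemannian_metric :: "('m, 'n::finite) atlas \<Rightarrow> 'm bilin \<Rightarrow> bool" where
  "riemannian_metric A g \<longleftrightarrow>
     (\<forall>p. \<forall>v\<in>tangent_space A p.
        (\<forall>w\<in>tangent_space A p. g p v w = g p w v \<and>
           (\<forall>u\<in>tangent_space A p. g p (v + w) u = g p v u + g p w u) \<and>
           (\<forall>c. g p (tscale c v) w = c * g p v w)) \<and>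
        (v \<noteq> 0 \<longrightarrow> g p v v > 0)) \<and>
     (\<forall>x y. vector_field A x \<longrightarrow> vector_field A y \<longrightarrow> smooth_fun A (bilin_apply g x y))"

definition tangent_basis ::
  "('m, 'n::finite) atlas \<Rightarrow> 'm \<Rightarrow> ('n \<Rightarrow> 'm tvec) \<Rightarrow> bool" where
  "tangent_basis A p e \<longleftrightarrow>
     (\<forall>i. e i \<in> tangent_space A p) \<and>
     (\<forall>v\<in>tangent_space A p. \<exists>!c :: real ^ 'n. v = (\<Sum>i\<in>UNIV. tscale (c $ i) (e i)))"

text \<open>The trace of the matrix \<open>C\<close> of an endomorphism \<open>L\<close> of the tangent space in any basis.\<close>

definition tangent_trace ::
  "('m, 'n::finite) atlas \<Rightarrow> 'm \<Rightarrow> ('m tvec \<Rightarrow> 'm tvec) \<Rightarrow> real" where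
  "tangent_trace A p L = (THE t. \<exists>e (C :: real ^ 'n ^ 'n).
     tangent_basis A p e \<and>
     (\<forall>j. L (e j) = (\<Sum>i\<in>UNIV. tscale (C $ i $ j) (e i))) \<and>
     t = trace C)"

type_synonym 'm conn = "'m vfield \<Rightarrow> 'm vfield \<Rightarrow> 'm vfield"

definition linear_connection :: "('m, 'n::finite) atlas \<Rightarrow> 'm conn \<Rightarrow> bool" where
  "linear_connection A D \<longleftrightarrow>
     (\<forall>x y. vector_field A x \<longrightarrow> vector_field A y \<longrightarrow>
        vector_field A (D x y) \<and>
        (\<forall>z. vector_field A z \<longrightarrow>
           D (x + y) z = D x z + D y z \<and> D z (x + y) = D z x + D z y) \<and>
        (\<forall>f. smooth_fun A f \<longrightarrow>
           D (fscale f x) y = fscale f (D x y) \<and>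
           D x (fscale f y) = fscale (deriv_along x f) y + fscale f (D x y)))"

definition torsion :: "'m conn \<Rightarrow> 'm vfield \<Rightarrow> 'm vfield \<Rightarrow> 'm vfield" where
  "torsion D x y = D x y - D y x - lie_bracket x y"

definition endo_deriv :: "'m conn \<Rightarrow> 'm endo \<Rightarrow> 'm vfield \<Rightarrow> 'm vfield \<Rightarrow> 'm vfield" where
  "endo_deriv D P x y = D x (endo_apply P y) - endo_apply P (D x y)"

definition metric_deriv ::
  "'m conn \<Rightarrow> 'm bilin \<Rightarrow> 'm vfield \<Rightarrow> 'm vfield \<Rightarrow> 'm vfield \<Rightarrow> 'm \<Rightarrow> real" where
  "metric_deriv D g x y z =
     deriv_along x (bilin_apply g y z) - bilin_apply g (D x y) z - bilin_apply g y (D x z)"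

definition parallel_endo :: "('m, 'n::finite) atlas \<Rightarrow> 'm conn \<Rightarrow> 'm endo \<Rightarrow> bool" where
  "parallel_endo A D P \<longleftrightarrow>
     (\<forall>x y. vector_field A x \<longrightarrow> vector_field A y \<longrightarrow> endo_deriv D P x y = 0)"

definition parallel_metric :: "('m, 'n::finite) atlas \<Rightarrow> 'm conn \<Rightarrow> 'm bilin \<Rightarrow> bool" where
  "parallel_metric A D g \<longleftrightarrow>
     (\<forall>x y z. vector_field A x \<longrightarrow> vector_field A y \<longrightarrow> vector_field A z \<longrightarrow>
        metric_deriv D g x y z = 0)"

definition levi_civita_connection ::
  "('m, 'n::finite) atlas \<Rightarrow> 'm bilin \<Rightarrow> 'm conn \<Rightarrow> bool" where
  "levi_civita_connection A g D \<longleftrightarrow>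
     linear_connection A D \<and> parallel_metric A D g \<and>
     (\<forall>x y. vector_field A x \<longrightarrow> vector_field A y \<longrightarrow> torsion D x y = 0)"

definition riemannian_almost_product ::
  "('m::{t2_space, second_countable_topology}, 'n::finite) atlas \<Rightarrow> 'm endo \<Rightarrow> 'm bilin \<Rightarrow> bool"
  where
  "riemannian_almost_product A P g \<longleftrightarrow>
     smooth_atlas A \<and> tensor_field_11 A P \<and> riemannian_metric A g \<and>
     (\<forall>x. vector_field A x \<longrightarrow> endo_apply P (endo_apply P x) = x) \<and>
     (\<forall>x y. vector_field A x \<longrightarrow> vector_field A y \<longrightarrow>
        bilin_apply g (endo_apply P x) (endo_apply P y) = bilin_apply g x y) \<and>
     (\<forall>p. tangent_trace A p (P p) = 0)"

definition structure_F ::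
  "'m conn \<Rightarrow> 'm endo \<Rightarrow> 'm bilin \<Rightarrow> 'm vfield \<Rightarrow> 'm vfield \<Rightarrow> 'm vfield \<Rightarrow> 'm \<Rightarrow> real" where
  "structure_F D P g x y z = bilin_apply g (endo_deriv D P x y) z"

text \<open>\<open>D\<close> is the Levi-Civita connection of \<open>g\<close>.\<close>

definition W3_manifold ::
  "('m::{t2_space, second_countable_topology}, 'n::finite) atlas
     \<Rightarrow> 'm endo \<Rightarrow> 'm bilin \<Rightarrow> 'm conn \<Rightarrow> bool" where
  "W3_manifold A P g D \<longleftrightarrow>
     riemannian_almost_product A P g \<and> levi_civita_connection A g D \<and>
     (\<forall>x y z. vector_field A x \<longrightarrow> vector_field A y \<longrightarrow> vector_field A z \<longrightarrow>
        structure_F D P g x y z + structure_F D P g y z x + structure_F D P g z x y = 0)"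

definition natural_connection ::
  "('m, 'n::finite) atlas \<Rightarrow> 'm endo \<Rightarrow> 'm bilin \<Rightarrow> 'm conn \<Rightarrow> bool" where
  "natural_connection A P g D \<longleftrightarrow>
     linear_connection A D \<and> parallel_endo A D P \<and> parallel_metric A D g"

definition torsion03 ::
  "'m bilin \<Rightarrow> 'm conn \<Rightarrow> 'm vfield \<Rightarrow> 'm vfield \<Rightarrow> 'm vfield \<Rightarrow> 'm \<Rightarrow> real" where
  "torsion03 g D x y z = bilin_apply g (torsion D x y) z"

definition canonical_connection ::
  "('m, 'n::finite) atlas \<Rightarrow> 'm endo \<Rightarrow> 'm bilin \<Rightarrow> 'm conn \<Rightarrow> bool" where
  "canonical_connection A P g D \<longleftrightarrow>
     natural_connection A P g D \<and>
     (\<forall>x y z. vector_field A x \<longrightarrow> vector_field A y \<longrightarrow> vector_field A z \<longrightarrow>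
        torsion03 g D x y z + torsion03 g D y z x
        + torsion03 g D (endo_apply P x) y (endo_apply P z)
        + torsion03 g D y (endo_apply P z) (endo_apply P x) = 0)"

definition torsion_p3 ::
  "'m endo \<Rightarrow> 'm bilin \<Rightarrow> 'm conn \<Rightarrow> 'm vfield \<Rightarrow> 'm vfield \<Rightarrow> 'm vfield \<Rightarrow> 'm \<Rightarrow> real" where
  "torsion_p3 P g D x y z = (\<lambda>q. 1 / 4 *
     (torsion03 g D x y z q
      + torsion03 g D (endo_apply P x) (endo_apply P y) z q
      - torsion03 g D (endo_apply P x) y (endo_apply P z) q
      - torsion03 g D x (endo_apply P y) (endo_apply P z) q))"

end

theory Submission
  imports Defs
begin

text \<open>
  Everything is read off from the difference \<open>Q(x,y,z) = g(\<nabla>'\<^sub>x y - \<nabla>\<^sub>x y, z)\<close>. As both connections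
  are metric, \<open>Q\<close> is skew in \<open>y, z\<close>; as \<open>P\<close> is parallel for \<open>\<nabla>'\<close> and self-adjoint, \<open>Q\<close> determines \<open>F\<close>
  by \<open>F(x,y,z) = Q(x,y,Pz) - Q(x,Py,z)\<close>; and as \<open>\<nabla>\<close> has no torsion,
  \<open>T(x,y,z) = Q(x,y,z) - Q(y,x,z)\<close>, so the canonical condition is a condition on \<open>Q\<close>.

  Think of the eigenspaces of \<open>P\<close> for the eigenvalues \<open>1\<close> and \<open>-1\<close>. A form in three
  arguments splits according to the signs of its arguments, and up to a common change of sign there
  are four types. When \<open>y\<close> and \<open>z\<close> have opposite signs, \<open>Q(x,y,z)\<close> is given by \<open>F\<close>. The canonical
  condition is empty when the signs of \<open>x\<close> and \<open>z\<close> differ; when they agree it says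
  \<open>2 Q(y,x,z) = Q(x,y,z) - Q(z,y,x)\<close>. If \<open>y\<close> has the other sign, this gives the part of \<open>Q\<close> whose
  direction has the sign opposite to both slots, again in terms of \<open>F\<close>. If all signs agree, this and
  the skewness force \<open>Q = 0\<close>. The three parts add up to the formula for \<open>\<nabla>'\<close>. Finally the
  cyclic condition on \<open>F\<close> makes \<open>F(x,y,z)\<close> skew in \<open>x, y\<close> for \<open>x, y\<close> of one sign and \<open>z\<close>
  of the other, and then \<open>T(x,y,z)\<close> survives only on this type. All the symmetries
  of \<open>T\<close> under \<open>P\<close> restate this.

  The eigenspace argument is carried out without splitting vectors: a component of \<open>Q\<close> is the
  corresponding signed combination of the values of \<open>Q\<close> on \<open>x, y, z\<close> and their images under \<open>P\<close>.
  This algebra takes place at a single point (\<open>Q_pure_part\<close>, \<open>Q_opposite_direction\<close>,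
  \<open>Q_opposite_slots\<close>, whence \<open>Q_formula\<close> and \<open>torsion_P\<close>). An identity of vector fields then follows
  from its pairings with all fields because \<open>g\<close> is definite (\<open>bilin_apply_eqI\<close>).
\<close>

section \<open>Algebra of the difference tensor\<close>

text \<open>
  The form \<open>Q\<close> stands for the values \<open>g(\<nabla>'\<^sub>x y - \<nabla>\<^sub>x y, z)\<close> at one fixed point. It is
  a function on a bare set because the identities below are linear in the real values of \<open>Q\<close>, while
  its arguments are only permuted and moved by the involution \<open>P\<close>.
\<close>

locale canonical_difference_form =
  fixes S :: "'v set" and P :: "'v \<Rightarrow> 'v" and Q F :: "'v \<Rightarrow> 'v \<Rightarrow> 'v \<Rightarrow> real"
  assumes P_closed [simp]: "x \<in> S \<Longrightarrow> P x \<in> S"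
    and P_P [simp]: "x \<in> S \<Longrightarrow> P (P x) = x"
    and skew: "\<lbrakk>x \<in> S; y \<in> S; z \<in> S\<rbrakk> \<Longrightarrow> Q x z y = - Q x y z"
    and F_eq: "\<lbrakk>x \<in> S; y \<in> S; z \<in> S\<rbrakk> \<Longrightarrow> F x y z = Q x y (P z) - Q x (P y) z"
    and canonical: "\<lbrakk>x \<in> S; y \<in> S; z \<in> S\<rbrakk> \<Longrightarrow>
       (Q x y z - Q y x z) + (Q y z x - Q z y x)
       + (Q (P x) y (P z) - Q y (P x) (P z)) + (Q y (P z) (P x) - Q (P z) y (P x)) = 0"
    and cyclic: "\<lbrakk>x \<in> S; y \<in> S; z \<in> S\<rbrakk> \<Longrightarrow> F x y z + F y z x + F z x y = 0"
begin

lemma F_sym: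
  assumes "x \<in> S" "y \<in> S" "z \<in> S"
  shows "F x z y = F x y z"
  using assms skew[of x y "P z"] skew[of x "P y" z] by (simp add: F_eq)

lemma F_P_middle:
  assumes "x \<in> S" "y \<in> S" "z \<in> S"
  shows "F x (P y) z = - F x y (P z)"
  using assms by (simp add: F_eq)

text \<open>
  Adding the cyclic identities for \<open>(x,y,z)\<close> and \<open>(Px,Py,z)\<close> keeps the components with \<open>x\<close> and \<open>y\<close> of
  the same sign. There \<open>F(z,x,y)\<close> vanishes, and what remains is the skewness of the rest in \<open>x, y\<close>.
\<close>

lemma cyclic_mixed_part:
  assumes S: "x \<in> S" "y \<in> S" "z \<in> S"
  shows "F x y z + F (P x) (P y) z = - (F y x z + F (P y) (P x) z)"
proof -
  have "F x y z + F y z x + F z x y = 0"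
    using S by (rule cyclic)
  moreover have "F (P x) (P y) z + F (P y) z (P x) + F z (P x) (P y) = 0"
    using S by (intro cyclic) auto
  moreover have "F z (P x) (P y) = - F z x y"
    using S F_P_middle[of z x "P y"] by simp
  moreover have "F y z x = F y x z" "F (P y) z (P x) = F (P y) (P x) z"
    using S by (simp_all add: F_sym)
  ultimately show ?thesis by linarith
qed

text \<open>
  The canonical condition with the skewness of \<open>Q\<close> used up. Both sides are the components in which
  \<open>x\<close> and \<open>z\<close> have the same sign.
\<close>

lemma canonical_skew:
  assumes S: "x \<in> S" "y \<in> S" "z \<in> S"
  shows "Q x y z - Q z y x + Q (P x) y (P z) - Q (P z) y (P x)
     = 2 * (Q y x z + Q y (P x) (P z))"
  using canonical[OF S] S skew[of y x z] skew[of y "P x" "P z"] by simp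

text \<open>
  The left-hand side \<open>R\<close> is four times the component with all three signs equal. On it
  the canonical condition reads \<open>R(x,y,z) + 2 R(y,z,x) + R(z,x,y) = 0\<close>; hence each of the three
  cyclic values is minus their sum, which is only possible if they vanish.
\<close>

lemma Q_pure_part:
  assumes S: "x \<in> S" "y \<in> S" "z \<in> S"
  shows "Q x y z + Q x (P y) (P z) + Q (P x) y (P z) + Q (P x) (P y) z = 0"
proof -
  define R where "R x y z = Q x y z + Q x (P y) (P z) + Q (P x) y (P z) + Q (P x) (P y) z"
    for x y z
  have R_skew: "R a c b = - R a b c" if "a \<in> S" "b \<in> S" "c \<in> S" for a b c
    using that skew[of a b c] skew[of a "P b" "P c"] skew[of "P a" b "P c"]
      skew[of "P a" "P b" c]
    by (simp add: R_def)
  have R_can: "R a b c - R c b a = 2 * R b a c" if "a \<in> S" "b \<in> S" "c \<in> S" for a b c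
    using that canonical_skew[of a b c] canonical_skew[of a "P b" "P c"]
    by (simp add: R_def)
  have "R x y z = 0"
    using R_can[OF S] R_can[of y z x] R_can[of z x y] R_skew[of x y z] R_skew[of y z x]
      R_skew[of z x y] S by linarith
  then show ?thesis by (simp add: R_def)
qed

text \<open>
  This is twice the part of \<open>Q\<close> in which \<open>y\<close> and \<open>z\<close> have opposite signs.
\<close>

lemma Q_opposite_slots:
  assumes "x \<in> S" "y \<in> S" "z \<in> S"
  shows "Q x y z - Q x (P y) (P z) = - F x (P y) z"
  using assms by (simp add: F_eq)

text \<open>
  This is four times the component in which \<open>y\<close> and \<open>z\<close> have the same sign and \<open>x\<close> the opposite
  one. The canonical condition expresses it through \<open>Q(y,x,z)\<close> and \<open>Q(z,x,y)\<close>, whose last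
  two arguments then have opposite signs, so that they are values of \<open>F\<close>. The expression in \<open>F\<close> is
  already skew in \<open>y, z\<close> by the cyclic condition, which leaves two equal halves.
\<close>

lemma Q_opposite_direction:
  assumes S: "x \<in> S" "y \<in> S" "z \<in> S"
  shows "Q x y z + Q x (P y) (P z) - Q (P x) y (P z) - Q (P x) (P y) z
     = F (P y) x z - F y (P x) z"
proof -
  \<comment> \<open>Up to the factor \<open>-4\<close>, the part of \<open>Q(a,x,c)\<close> with \<open>a\<close>, \<open>c\<close> of one sign and \<open>x\<close> of the other.\<close>
  define E where "E a c = F a (P x) c - F (P a) x c" for a c
  have E_eq: "Q a x c + Q (P a) x (P c) - Q a (P x) (P c) - Q (P a) (P x) c = - E a c"
    if "a \<in> S" "c \<in> S" for a c
    using S that by (simp add: E_def F_eq)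
  have "2 * (Q x y z + Q x (P y) (P z) - Q (P x) y (P z) - Q (P x) (P y) z) = E z y - E y z"
    using canonical_skew[of y x z] canonical_skew[of y "P x" "P z"] E_eq[of y z] E_eq[of z y] S
    by simp
  moreover have "E z y = - E y z"
    using cyclic_mixed_part[of y z "P x"] F_sym[of y z "P x"] F_sym[of z y "P x"]
      F_sym[of "P y" "P z" "P x"] F_sym[of "P z" "P y" "P x"]
      F_P_middle[of "P y" x "P z"] F_P_middle[of "P z" x "P y"] S
    by (simp add: E_def)
  ultimately show ?thesis
    by (simp add: E_def)
qed

lemma Q_formula:
  assumes S: "x \<in> S" "y \<in> S" "z \<in> S"
  shows "4 * Q x y z = - F y (P x) z + F (P y) x z - 2 * F x (P y) z"
  using Q_pure_part[OF S] Q_opposite_direction[OF S] Q_opposite_slots[OF S] by linarith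

text \<open>
  By this formula \<open>T\<close> lives only on arguments \<open>x, y\<close> of the same sign and \<open>z\<close> of the opposite sign:
  the sum over \<open>Py, x\<close> and \<open>y, Px\<close> removes different signs of \<open>x\<close> and \<open>y\<close>, and \<open>F\<close> itself vanishes when
  its last two arguments have equal signs.
\<close>

lemma torsion_formula:
  assumes S: "x \<in> S" "y \<in> S" "z \<in> S"
  shows "2 * (Q x y z - Q y x z) = F (P y) x z + F y (P x) z"
  using Q_formula[of x y z] Q_formula[of y x z] cyclic_mixed_part[of "P y" x z] S by simp

lemma torsion_P:
  assumes S: "x \<in> S" "y \<in> S" "z \<in> S"
  shows "Q (P x) y z - Q y (P x) z = Q x (P y) z - Q (P y) x z"
    and "Q x (P y) z - Q (P y) x z = - (Q x y (P z) - Q y x (P z))"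
  using S torsion_formula[of "P x" y z] torsion_formula[of x "P y" z]
    torsion_formula[of x y "P z"] F_P_middle[of "P y" x z] F_P_middle[of y x z]
    F_P_middle[of y x "P z"]
  by auto

end

section \<open>Smooth functions and vector fields form linear spaces\<close>

text \<open>
  Openness of \<open>S\<close> is essential: the recursion in \<open>Ck_on\<close> uses derivatives at points of \<open>S\<close>, which
  depend on values nearby.
\<close>

lemma Ck_on_cong:
  assumes "open S" "\<And>x. x \<in> S \<Longrightarrow> f x = h x"
  shows "Ck_on k f S \<longleftrightarrow> Ck_on k h S"
  using assms(2)
proof (induction k arbitrary: f h)
  case 0
  then show ?case
    by (simp cong: continuous_on_cong)
next
  case (Suc k)
  have deriv: "(f has_derivative f') (at x) \<longleftrightarrow> (h has_derivative f') (at x)" if "x \<in> S" for f' x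
    using that Suc.prems assms(1)
    by (metis has_derivative_transform_within_open)
  then have "frechet_derivative f (at x) = frechet_derivative h (at x)" if "x \<in> S" for x
    using that by (simp add: frechet_derivative_def)
  moreover have "f differentiable at x \<longleftrightarrow> h differentiable at x" if "x \<in> S" for x
    using that deriv by (simp add: differentiable_def)
  moreover have "Ck_on k (\<lambda>x. frechet_derivative f (at x) v) S
      \<longleftrightarrow> Ck_on k (\<lambda>x. frechet_derivative h (at x) v) S" for v
    using calculation(1) by (intro Suc.IH) simp
  ultimately show ?case
    by simp
qed

lemma Ck_on_affine:
  fixes f h :: "'a::real_normed_vector \<Rightarrow> real"
  assumes "open S" "Ck_on k f S" "Ck_on k h S"
  shows "Ck_on k (\<lambda>x. c * f x + h x) S"
  using assms(2,3)
proof (induction k arbitrary: f h)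
  case 0
  then show ?case
    by (auto intro!: continuous_intros)
next
  case (Suc k)
  have deriv: "((\<lambda>x. c * f x + h x) has_derivative
      (\<lambda>v. c * frechet_derivative f (at x) v + frechet_derivative h (at x) v)) (at x)"
    if "x \<in> S" for x
    using that Suc.prems
    by (intro has_derivative_add has_derivative_mult_right) (simp_all flip: frechet_derivative_works)
  have "Ck_on k (\<lambda>x. frechet_derivative (\<lambda>x. c * f x + h x) (at x) v) S" for v
  proof -
    have "frechet_derivative (\<lambda>x. c * f x + h x) (at x) v
        = c * frechet_derivative f (at x) v + frechet_derivative h (at x) v" if "x \<in> S" for x
      using fun_cong[OF frechet_derivative_at[OF deriv[OF that]], of v] by simp
    moreover have "Ck_on k (\<lambda>x. c * frechet_derivative f (at x) v
        + frechet_derivative h (at x) v) S"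
      using Suc.prems by (intro Suc.IH) simp_all
    ultimately show ?thesis
      by (subst Ck_on_cong[OF assms(1)])
  qed
  then show ?case
    using differentiableI[OF deriv] by simp
qed

lemma smooth_fun_affine:
  assumes "smooth_atlas A" "smooth_fun A f" "smooth_fun A h"
  shows "smooth_fun A (\<lambda>q. c * f q + h q)"
  using assms unfolding smooth_fun_def smooth_on_def smooth_atlas_def o_def
  by (auto intro!: Ck_on_affine)

lemma tangent_space_affine:
  assumes "v \<in> tangent_space A p" "w \<in> tangent_space A p"
  shows "tscale c v + w \<in> tangent_space A p"
  using assms by (auto simp: tangent_space_def tscale_def algebra_simps)

text \<open>
  This is what makes the torsion of \<open>\<nabla>'\<close> a vector field: since \<open>\<nabla>\<close> has no torsion, it is a linear
  combination of values of \<open>\<nabla>'\<close> and \<open>\<nabla>\<close>.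
\<close>

lemma vector_field_affine:
  assumes A: "smooth_atlas A" and x: "vector_field A x" and y: "vector_field A y"
  shows "vector_field A (cscale c x + y)"
  unfolding vector_field_def
proof (intro conjI allI impI)
  show "(cscale c x + y) p \<in> tangent_space A p" for p
    using x y by (simp add: vector_field_def fscale_def tangent_space_affine)
  show "smooth_fun A (deriv_along (cscale c x + y) f)" if "smooth_fun A f" for f
    using x y that smooth_fun_affine[OF A, of "deriv_along x f" "deriv_along y f" c]
    by (simp add: vector_field_def fscale_def tscale_def deriv_along_def)
qed

lemma cscale_one [simp]: "cscale 1 x = x"
  and cscale_minus_one: "cscale (- 1) x = - x"
  by (simp_all add: fscale_def tscale_def fun_eq_iff)

lemma vector_field_closed:
  assumes A: "smooth_atlas A" and x: "vector_field A x"
  shows "vector_field A (cscale c x)"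
    and "vector_field A (- x)"
    and "vector_field A y \<Longrightarrow> vector_field A (x + y)"
    and "vector_field A y \<Longrightarrow> vector_field A (x - y)"
proof -
  have "cscale (- 1) x + x = 0" "cscale c x + 0 = cscale c x"
    by (simp_all add: cscale_minus_one)
  then show c: "vector_field A (cscale c x)" for c
    using vector_field_affine[OF A x x, of "- 1"] vector_field_affine[OF A x, of 0 c] by simp
  show "vector_field A (- x)"
    using c[of "- 1"] by (simp add: cscale_minus_one)
  show "vector_field A (x + y)" if "vector_field A y"
    using vector_field_affine[OF A x that, of 1] by simp
  show "vector_field A (x - y)" if "vector_field A y"
    using vector_field_affine[OF A that x, of "- 1"] by (simp add: cscale_minus_one)
qed

section \<open>Linearity of metrics, endomorphisms and connections on vector fields\<close>

lemma vector_field_tangent: "vector_field A x \<Longrightarrow> x p \<in> tangent_space A p"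
  by (simp add: vector_field_def)

lemma bilin_apply_sym:
  assumes "riemannian_metric A g" "vector_field A x" "vector_field A y"
  shows "bilin_apply g x y = bilin_apply g y x"
  using assms by (auto simp: riemannian_metric_def bilin_apply_def vector_field_tangent)

lemma bilin_apply_add:
  assumes "riemannian_metric A g" "vector_field A x" "vector_field A y" "vector_field A z"
  shows "bilin_apply g (x + y) z = bilin_apply g x z + bilin_apply g y z"
  using assms
  by (auto simp: riemannian_metric_def bilin_apply_def vector_field_tangent fun_eq_iff)

lemma bilin_apply_cscale:
  assumes "riemannian_metric A g" "vector_field A x" "vector_field A z"
  shows "bilin_apply g (cscale c x) z q = c * bilin_apply g x z q"
  using assms
  by (auto simp: riemannian_metric_def bilin_apply_def fscale_def vector_field_tangent)

lemma bilin_apply_minus: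
  assumes "riemannian_metric A g" "vector_field A x" "vector_field A z"
  shows "bilin_apply g (- x) z = - bilin_apply g x z"
  using bilin_apply_cscale[OF assms, of "- 1"] by (simp add: cscale_minus_one fun_eq_iff)

lemma bilin_apply_diff:
  assumes "smooth_atlas A" "riemannian_metric A g"
    "vector_field A x" "vector_field A y" "vector_field A z"
  shows "bilin_apply g (x - y) z = bilin_apply g x z - bilin_apply g y z"
  using assms bilin_apply_add[of A g x "- y" z] bilin_apply_minus[of A g y z]
  by (simp add: vector_field_closed)

text \<open>Definiteness suffices: pair \<open>x - y\<close> with itself.\<close>

lemma bilin_apply_eqI:
  assumes A: "smooth_atlas A" and g: "riemannian_metric A g"
    and x: "vector_field A x" and y: "vector_field A y"
    and eq: "\<And>z q. vector_field A z \<Longrightarrow> bilin_apply g x z q = bilin_apply g y z q"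
  shows "x = y"
proof -
  have vf: "vector_field A (x - y)"
    using A x y by (simp add: vector_field_closed)
  have "(x - y) q = 0" for q
  proof (rule ccontr)
    assume "(x - y) q \<noteq> 0"
    then have "g q ((x - y) q) ((x - y) q) > 0"
      using g vector_field_tangent[OF vf, of q] unfolding riemannian_metric_def by blast
    moreover have "bilin_apply g (x - y) (x - y) q = 0"
      using bilin_apply_diff[OF A g x y vf] eq[OF vf] by simp
    ultimately show False
      by (simp add: bilin_apply_def)
  qed
  then have "x - y = 0"
    by (simp add: fun_eq_iff)
  then show ?thesis by simp
qed

lemma endo_apply_minus:
  assumes P: "tensor_field_11 A P" and x: "vector_field A x"
  shows "endo_apply P (- x) = - endo_apply P x"
proof -
  have "endo_apply P (cscale (- 1) x) = cscale (- 1) (endo_apply P x)"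
    using P vector_field_tangent[OF x] by (auto simp: tensor_field_11_def endo_apply_def fscale_def)
  then show ?thesis
    by (simp add: cscale_minus_one)
qed

lemma endo_apply_diff:
  assumes A: "smooth_atlas A" and P: "tensor_field_11 A P"
    and x: "vector_field A x" and y: "vector_field A y"
  shows "endo_apply P (x - y) = endo_apply P x - endo_apply P y"
proof -
  have "endo_apply P (x + z) = endo_apply P x + endo_apply P z" if "vector_field A z" for z
    using P vector_field_tangent[OF x] vector_field_tangent[OF that]
    by (simp add: tensor_field_11_def endo_apply_def fun_eq_iff)
  from this[of "- y"] show ?thesis
    using A y by (simp add: vector_field_closed endo_apply_minus[OF P])
qed

lemma linear_connection_minus:
  assumes A: "smooth_atlas A" and D: "linear_connection A D"
    and x: "vector_field A x" and y: "vector_field A y"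
  shows "D (- x) y = - D x y" "D y (- x) = - D y x"
proof -
  have add: "D (u + v) y = D u y + D v y" "D y (u + v) = D y u + D y v"
    if "vector_field A u" "vector_field A v" for u v
    using D that y unfolding linear_connection_def by blast+
  have "vector_field A 0"
    using vector_field_closed(4)[OF A x x] by simp
  then have "D 0 y = 0" "D y 0 = 0"
    using add[of 0 0] by auto
  then show "D (- x) y = - D x y" "D y (- x) = - D y x"
    using add[of x "- x"] x A by (auto simp: vector_field_closed add_eq_0_iff)
qed

theorem proposition4p2:
  fixes A :: "('m::{t2_space, second_countable_topology}, 'n::finite) atlas"
    and P\<^sub>0 :: "'m endo" and P :: "'m vfield \<Rightarrow> 'm vfield"
    and g :: "'m bilin"
    and D D' :: "'m conn"
    and T :: "'m vfield \<Rightarrow> 'm vfield \<Rightarrow> 'm vfield"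
    and T3 :: "'m vfield \<Rightarrow> 'm vfield \<Rightarrow> 'm vfield \<Rightarrow> 'm \<Rightarrow> real"
  assumes "W3_manifold A P\<^sub>0 g D"
    and "canonical_connection A P\<^sub>0 g D'"
    and P_def: "P = endo_apply P\<^sub>0"
    and T_def: "T = torsion D'"
    and T3_def: "T3 = torsion03 g D'"
  shows "\<forall>x y z w.
    vector_field A x \<longrightarrow> vector_field A y \<longrightarrow> vector_field A z \<longrightarrow> vector_field A w \<longrightarrow>
      T (P x) y = - P (T x y) \<and>
      (T3 (P x) y z = T3 x (P y) z \<and> T3 x (P y) z = - T3 x y (P z)) \<and>
      (T3 (T (P x) (P y)) z w = T3 (T (P x) y) z (P w) \<and>
       T3 (T (P x) y) z (P w) = T3 (T x (P y)) z (P w) \<and>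
       T3 (T x (P y)) z (P w) = T3 (T x y) z w) \<and>
      T3 x y z = torsion_p3 P\<^sub>0 g D' x y z \<and>
      D' x y = D x y + cscale (1 / 4)
        (- endo_deriv D P\<^sub>0 y (P x) + endo_deriv D P\<^sub>0 (P y) x
         - cscale 2 (endo_deriv D P\<^sub>0 x (P y)))"
proof -
  have A: "smooth_atlas A" and P0: "tensor_field_11 A P\<^sub>0" and g: "riemannian_metric A g"
    and PP: "\<And>x. vector_field A x \<Longrightarrow> P (P x) = x"
    and isometry: "\<And>x y. vector_field A x \<Longrightarrow> vector_field A y \<Longrightarrow>
      bilin_apply g (P x) (P y) = bilin_apply g x y"
    and D: "linear_connection A D" and Dg: "parallel_metric A D g"
    and D_torsion: "\<And>x y. vector_field A x \<Longrightarrow> vector_field A y \<Longrightarrow> torsion D x y = 0"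
    and F_cyclic: "\<And>x y z. \<lbrakk>vector_field A x; vector_field A y; vector_field A z\<rbrakk> \<Longrightarrow>
        structure_F D P\<^sub>0 g x y z + structure_F D P\<^sub>0 g y z x + structure_F D P\<^sub>0 g z x y = 0"
    using assms(1)
    by (auto simp: W3_manifold_def riemannian_almost_product_def levi_civita_connection_def P_def)
  have D': "linear_connection A D'" and D'g: "parallel_metric A D' g"
    and D'P: "\<And>x y. vector_field A x \<Longrightarrow> vector_field A y \<Longrightarrow> endo_deriv D' P\<^sub>0 x y = 0"
    and T_canonical: "\<And>x y z. \<lbrakk>vector_field A x; vector_field A y; vector_field A z\<rbrakk> \<Longrightarrow>
        T3 x y z + T3 y z x + T3 (P x) y (P z) + T3 y (P z) (P x) = 0"
    using assms(2)
    by (auto simp: canonical_connection_def natural_connection_def parallel_endo_def P_def T3_def)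
  define K where "K x y = D' x y - D x y" for x y
  note closed = vector_field_closed[OF A]
  note gsimps = bilin_apply_diff[OF A g] bilin_apply_add[OF g] bilin_apply_minus[OF g]
    bilin_apply_cscale[OF g]
  have P_vf: "vector_field A (P x)" if "vector_field A x" for x
    using P0 that by (simp add: tensor_field_11_def P_def)
  have D_vf: "vector_field A (D x y)" "vector_field A (D' x y)"
    if "vector_field A x" "vector_field A y" for x y
    using D D' that by (auto simp: linear_connection_def)
  then have K_vf: "vector_field A (K x y)" if "vector_field A x" "vector_field A y" for x y
    using that by (simp add: K_def closed)
  have P_minus: "P (- x) = - P x" if "vector_field A x" for x
    using endo_apply_minus[OF P0 that] by (simp add: P_def)
  have K_minus: "K (- x) y = - K x y" "K y (- x) = - K y x"
    if "vector_field A x" "vector_field A y" for x y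
    using that linear_connection_minus[OF A D, of x y] linear_connection_minus[OF A D', of x y]
    by (simp_all add: K_def fun_eq_iff)
  \<comment> \<open>The bracket cancels against the vanishing torsion of \<open>D\<close>.\<close>
  have T_K: "T x y = K x y - K y x" if "vector_field A x" "vector_field A y" for x y
    using D_torsion[OF that] by (simp add: T_def K_def torsion_def algebra_simps)
  have T_vf: "vector_field A (T x y)" if "vector_field A x" "vector_field A y" for x y
    using that by (simp add: T_K closed K_vf)
  have T_minus: "T (- x) y = - T x y" if "vector_field A x" "vector_field A y" for x y
    using that by (simp add: T_K closed K_minus)
  have T3_K: "T3 x y z = bilin_apply g (K x y) z - bilin_apply g (K y x) z"
    if "vector_field A x" "vector_field A y" "vector_field A z" for x y z
    using that by (simp add: T3_def torsion03_def T_def[symmetric] T_K gsimps K_vf)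
  have P_adjoint: "bilin_apply g (P x) y = bilin_apply g x (P y)"
    if "vector_field A x" "vector_field A y" for x y
    using isometry[of x "P y"] that by (simp add: PP P_vf)
  have DP_K: "endo_deriv D P\<^sub>0 x y = P (K x y) - K x (P y)"
    if "vector_field A x" "vector_field A y" for x y
    using D'P[OF that] endo_apply_diff[OF A P0] that
    by (simp add: endo_deriv_def K_def P_def[symmetric] D_vf algebra_simps)
  have DP_vf: "vector_field A (endo_deriv D P\<^sub>0 x y)"
    if "vector_field A x" "vector_field A y" for x y
    using that by (simp add: DP_K closed K_vf P_vf)
  have form: "canonical_difference_form (Collect (vector_field A)) P
      (\<lambda>x y z. bilin_apply g (K x y) z q) (\<lambda>x y z. structure_F D P\<^sub>0 g x y z q)" for q
  proof (unfold_locales, unfold mem_Collect_eq)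
    show "vector_field A (P x)" "P (P x) = x" if "vector_field A x" for x
      using that by (simp_all add: P_vf PP)
  next
    fix x y z assume vf: "vector_field A x" "vector_field A y" "vector_field A z"
    have "metric_deriv D g x y z q = 0" "metric_deriv D' g x y z q = 0"
      using Dg D'g vf by (simp_all add: parallel_metric_def)
    then show "bilin_apply g (K x z) y q = - bilin_apply g (K x y) z q"
      using vf bilin_apply_sym[OF g, of y "D x z"] bilin_apply_sym[OF g, of y "D' x z"]
      by (simp add: metric_deriv_def K_def gsimps D_vf)
    show "structure_F D P\<^sub>0 g x y z q
        = bilin_apply g (K x y) (P z) q - bilin_apply g (K x (P y)) z q"
      using vf by (simp add: structure_F_def DP_K gsimps K_vf P_vf P_adjoint)
    show "structure_F D P\<^sub>0 g x y z q + structure_F D P\<^sub>0 g y z x q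
        + structure_F D P\<^sub>0 g z x y q = 0"
      using fun_cong[OF F_cyclic[OF vf], of q] by simp
    show "bilin_apply g (K x y) z q - bilin_apply g (K y x) z q
      + (bilin_apply g (K y z) x q - bilin_apply g (K z y) x q)
      + (bilin_apply g (K (P x) y) (P z) q - bilin_apply g (K y (P x)) (P z) q)
      + (bilin_apply g (K y (P z)) (P x) q - bilin_apply g (K (P z) y) (P x) q) = 0"
      using fun_cong[OF T_canonical[OF vf], of q] vf by (simp add: T3_K P_vf)
  qed
  have T3_P: "T3 (P x) y z = T3 x (P y) z" "T3 x (P y) z = - T3 x y (P z)"
    if "vector_field A x" "vector_field A y" "vector_field A z" for x y z
    using that canonical_difference_form.torsion_P[OF form, of x y z]
    by (simp_all add: T3_K P_vf fun_eq_iff)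
  have T_P: "T (P x) y = - P (T x y)" "T x (P y) = - P (T x y)"
    if "vector_field A x" "vector_field A y" for x y
  proof -
    have "bilin_apply g (T (P x) y) z = bilin_apply g (- P (T x y)) z"
      "bilin_apply g (T x (P y)) z = bilin_apply g (- P (T x y)) z"
      if "vector_field A z" for z
      using T3_P[of x y z] \<open>vector_field A x\<close> \<open>vector_field A y\<close> that
      by (simp_all add: T3_def torsion03_def T_def[symmetric] gsimps T_vf P_vf P_adjoint)
    then show "T (P x) y = - P (T x y)" "T x (P y) = - P (T x y)"
      using that by (auto intro!: bilin_apply_eqI[OF A g] simp: closed T_vf P_vf)
  qed
  \<comment> \<open>With \<open>u = T x y\<close> this covers both middle terms of the chain for \<open>T3 (T _ _) _ _\<close>.\<close>
  have T3_T: "T3 (- P u) z (P w) = T3 u z w"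
    if "vector_field A u" "vector_field A z" "vector_field A w" for u z w
  proof -
    have "T3 (- P u) z (P w) = - T3 (P u) z (P w)"
      using that by (simp add: T3_def torsion03_def T_def[symmetric] T_minus T_vf P_vf gsimps)
    then show ?thesis
      using that T3_P[of u z "P w"] by (simp add: P_vf PP)
  qed
  have K_formula: "K x y = cscale (1 / 4)
        (- endo_deriv D P\<^sub>0 y (P x) + endo_deriv D P\<^sub>0 (P y) x
         - cscale 2 (endo_deriv D P\<^sub>0 x (P y)))" (is "_ = cscale (1 / 4) ?R")
    if "vector_field A x" "vector_field A y" for x y
  proof (rule bilin_apply_eqI[OF A g])
    have R_vf: "vector_field A ?R"
      using that by (simp add: closed DP_vf P_vf)
    show "vector_field A (K x y)" "vector_field A (cscale (1 / 4) ?R)"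
      using that R_vf by (simp_all add: K_vf closed)
    fix z q assume z: "vector_field A z"
    have "bilin_apply g ?R z q = 4 * bilin_apply g (K x y) z q"
      using that z canonical_difference_form.Q_formula[OF form, of x y z q]
      by (simp add: gsimps closed DP_vf P_vf structure_F_def)
    then show "bilin_apply g (K x y) z q = bilin_apply g (cscale (1 / 4) ?R) z q"
      using z R_vf by (simp add: gsimps)
  qed
  show ?thesis
  proof (intro allI impI)
    fix x y z w
    assume vf: "vector_field A x" "vector_field A y" "vector_field A z" "vector_field A w"
    have T_PP: "T (P x) (P y) = T x y"
      using vf T_P(1)[of x "P y"] T_P(2)[of x y] P_minus[OF P_vf[OF T_vf]] by (simp add: P_vf PP T_vf)
    have p3: "T3 x y z = torsion_p3 P\<^sub>0 g D' x y z"
      using vf T3_P[of x y "P z"] T3_P[of x "P y" z]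
      by (simp add: torsion_p3_def P_def[symmetric] T3_def[symmetric] PP P_vf fun_eq_iff)
    show "T (P x) y = - P (T x y) \<and>
      (T3 (P x) y z = T3 x (P y) z \<and> T3 x (P y) z = - T3 x y (P z)) \<and>
      (T3 (T (P x) (P y)) z w = T3 (T (P x) y) z (P w) \<and>
       T3 (T (P x) y) z (P w) = T3 (T x (P y)) z (P w) \<and>
       T3 (T x (P y)) z (P w) = T3 (T x y) z w) \<and>
      T3 x y z = torsion_p3 P\<^sub>0 g D' x y z \<and>
      D' x y = D x y + cscale (1 / 4)
        (- endo_deriv D P\<^sub>0 y (P x) + endo_deriv D P\<^sub>0 (P y) x
         - cscale 2 (endo_deriv D P\<^sub>0 x (P y)))"
      using vf T_PP p3 K_formula[of x y]
      by (simp add: T_P T3_P T3_T T_vf K_def algebra_simps)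
  qed
qed

end
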